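(* Let $n\ge0$ be an integer and let $H=H(x^1,x^2)>0$ satisfy $\partial_1^2H+\partial_2^2H=0$. For each of the following towers and each choice of time directions listed, the stated diagonal metric together with the potential $A_{\{q\}}=1/H$ satisfies the equations of motion of the effective action $\int d^{11}x\sqrt{|g|}\,\big(R-\tfrac{\epsilon}{2}F_{i\{q\}}F^{i\{q\}}\big)$, that is, both the field equation of $A_{\{q\}}$ and the Einstein equations $R^\mu{}_\nu-\frac12\delta^\mu_\nu R=T^\mu{}_\nu$ (all as in the context). (i) 3-tower (level $1+3n$): $|g_{11}|=|g_{22}|=H^{1/3+n}$, $|g_{33}|=\dots=|g_{88}|=H^{1/3}$, $|g_{99}|=|g_{10\,10}|=|g_{11\,11}|=H^{-2/3}$, with $$X=g^{99}g^{10\,10}g^{11\,11}\,[g^{33}g^{44}\cdots g^{11\,11}]^n;$$ time directions $\{9\}$ or $\{10,11\}$ for $n$ even, $\{3\}$ or $\{4,5,6,7,8\}$ for $n$ odd. (ii) 6-tower (level $2+3n$): $|g_{11}|=|g_{22}|=H^{2/3+n}$, $|g_{33}|=\dots=|g_{88}|=H^{-1/3}$, $|g_{99}|=|g_{10\,10}|=|g_{11\,11}|=H^{2/3}$, with $$X=g^{33}g^{44}g^{55}g^{66}g^{77}g^{88}\,[g^{33}g^{44}\cdots g^{11\,11}]^n;$$ time directions $\{3\}$ or $\{4,5,6,7,8\}$ for $n$ even, $\{9\}$ or $\{10,11\}$ for $n$ odd. (iii) $[8,1]$-tower (level $3+3n$): $|g_{11}|=|g_{22}|=H^{n+1}$,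 $|g_{33}|=H$, $|g_{11\,11}|=H^{-1}$, $|g_{aa}|=1$ for $a=4,\dots,10$, with $$X=g^{44}g^{55}\cdots g^{10\,10}(g^{11\,11})^2\,[g^{33}g^{44}\cdots g^{11\,11}]^n;$$ time directions $\{9,10\}$ or $\{4,5,6,7,8\}$ for $n$ even, $\{3\}$ or $\{11\}$ for $n$ odd.
   Context: Coordinates are $x^1,\dots,x^{11}$. Here $g_{11}$, $g^{11}$ denote components in the direction $x^1$, and $g_{11\,11}$, $g^{11\,11}$ those in the direction $x^{11}$. The metric is diagonal; $g_{aa}<0$ exactly for the listed time directions $a$ and $g_{aa}>0$ otherwise. All fields depend only on $x^1,x^2$. The constant $\epsilon$ is $+1$ if the number of time directions is odd and $-1$ if it is even. $A_{\{q\}}$ is a single component of a mixed-symmetry tensor potential with tensor indices $\{q\}$, $F_{i\{q\}}=\partial_iA_{\{q\}}$ with $i=1,2$, and indices are raised with the inverse metric, each index in $\{q\}$ being raised as often as it occurs. Thus $$F_{i\{q\}}F^{i\{q\}}=X\sum_{i,j=1}^2g^{ij}\,\partial_iA_{\{q\}}\,\partial_jA_{\{q\}},$$ where $X$ is the product of inverse metric components listed for each tower. The field equation is $\sum_{i,j=1}^2\partial_i\big(\sqrt{|g|}\,g^{ij}X\,\partial_jA_{\{q\}}\big)=0$. The energy–momentum tensor is obtained by varying the matter term $\ell=-\frac{\epsilon}{2}X\,g^{ij}\partial_iA_{\{q\}}\partial_jA_{\{q\}}$ with respect to the metric: $T_{\mu\nu}=-\frac{\partial\ell}{\partial g^{\mu\nu}}+\frac12g_{\mu\nu}\ell$,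 where $X$ is regarded as a function of the inverse metric components occurring in it. *)

theory Defs
  imports "HOL-Analysis.Analysis"
begin

definition pd :: "'n::finite \<Rightarrow> (real^'n \<Rightarrow> real) \<Rightarrow> real^'n \<Rightarrow> real" where
  "pd i f x = deriv (\<lambda>t. f (x + t *\<^sub>R axis i 1)) 0"

definition C2_on :: "(real^'n::finite) set \<Rightarrow> (real^'n \<Rightarrow> real) \<Rightarrow> bool" where
  "C2_on U f \<longleftrightarrow> f differentiable_on U \<and> (\<forall>i. pd i f differentiable_on U) \<and>
     (\<forall>i j. continuous_on U (pd i (pd j f)))"

text \<open>
  A metric is a matrix-valued function \<open>G\<close> with \<open>G x $ \<mu> $ \<nu> = g\<^sub>\<mu>\<^sub>\<nu>(x)\<close>. Sign conventions:
  \<open>R\<close> is positive on round spheres, and the Ricci tensor contracts the first and third index of the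
  Riemann tensor.
\<close>

definition christoffel ::
  "(real^'n \<Rightarrow> real^'n^'n) \<Rightarrow> 'n::finite \<Rightarrow> 'n \<Rightarrow> 'n \<Rightarrow> real^'n \<Rightarrow> real" where
  "christoffel G l m k x = (1/2) * (\<Sum>s\<in>UNIV. matrix_inv (G x) $ l $ s *
     (pd m (\<lambda>y. G y $ s $ k) x + pd k (\<lambda>y. G y $ s $ m) x - pd s (\<lambda>y. G y $ m $ k) x))"

definition riemann ::
  "(real^'n \<Rightarrow> real^'n^'n) \<Rightarrow> 'n::finite \<Rightarrow> 'n \<Rightarrow> 'n \<Rightarrow> 'n \<Rightarrow> real^'n \<Rightarrow> real" where
  "riemann G r s m k x =
     pd m (christoffel G r k s) x - pd k (christoffel G r m s) x
     + (\<Sum>l\<in>UNIV. christoffel G r m l x * christoffel G l k s x)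
     - (\<Sum>l\<in>UNIV. christoffel G r k l x * christoffel G l m s x)"

definition ricci :: "(real^'n \<Rightarrow> real^'n^'n) \<Rightarrow> real^'n \<Rightarrow> real^'n^'n::finite" where
  "ricci G x = (\<chi> m k. \<Sum>r\<in>UNIV. riemann G r m r k x)"

definition scalar_curvature :: "(real^'n \<Rightarrow> real^'n^'n) \<Rightarrow> real^'n::finite \<Rightarrow> real" where
  "scalar_curvature G x = (\<Sum>m\<in>UNIV. \<Sum>k\<in>UNIV. matrix_inv (G x) $ m $ k * ricci G x $ m $ k)"

text \<open>
  Spacetime is (an open subset of) \<open>real^11\<close>, indexed by the numeral type \<open>11\<close>, so that \<open>x $ a\<close>
  is the coordinate \<open>x\<^sup>a\<close> for \<open>a = 1, \<dots>, 11\<close>. In that type \<open>11\<close> and \<open>0\<close> denote the same element,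
  the other numerals \<open>1, \<dots>, 10\<close> are distinct from it and from each other; the induced order is
  not used.

  The argument \<open>X\<close> is the product of inverse metric components as a function of the inverse
  metric \<open>P\<close>, and \<open>d i\<close> stands for \<open>\<partial>\<^sub>i A\<close>.
\<close>

definition field_strength_sq ::
  "(real^11^11 \<Rightarrow> real) \<Rightarrow> real^11^11 \<Rightarrow> (11 \<Rightarrow> real) \<Rightarrow> real" where
  "field_strength_sq X P d = X P * (\<Sum>i\<in>{1,2}. \<Sum>j\<in>{1,2}. P $ i $ j * d i * d j)"

definition matter_term ::
  "real \<Rightarrow> (real^11^11 \<Rightarrow> real) \<Rightarrow> real^11^11 \<Rightarrow> (11 \<Rightarrow> real) \<Rightarrow> real" where
  "matter_term \<epsilon> X P d = - (\<epsilon>/2) * field_strength_sq X P d"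

text \<open>
  The derivative with respect to \<open>g\<^sup>\<mu>\<^sup>\<nu>\<close> treats all 121 entries of the inverse metric as independent
  variables. As the matter term is invariant under transposing \<open>P\<close>, the resulting matrix \<open>D\<close> is
  symmetric at symmetric \<open>P\<close> and satisfies \<open>\<delta>\<ell> = \<Sum>\<^sub>\<mu>\<^sub>\<nu> D\<^sub>\<mu>\<^sub>\<nu> \<delta>g\<^sup>\<mu>\<^sup>\<nu>\<close>.
\<close>

definition matter_term_deriv ::
  "real \<Rightarrow> (real^11^11 \<Rightarrow> real) \<Rightarrow> real^11^11 \<Rightarrow> (11 \<Rightarrow> real) \<Rightarrow> 11 \<Rightarrow> 11 \<Rightarrow> real" where
  "matter_term_deriv \<epsilon> X P d \<mu> \<nu> =
     deriv (\<lambda>t. matter_term \<epsilon> X (P + t *\<^sub>R axis \<mu> (axis \<nu> 1)) d) 0"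

definition energy_momentum ::
  "real \<Rightarrow> (real^11^11 \<Rightarrow> real) \<Rightarrow> (real^11 \<Rightarrow> real^11^11) \<Rightarrow> (real^11 \<Rightarrow> real) \<Rightarrow>
   real^11 \<Rightarrow> real^11^11" where
  "energy_momentum \<epsilon> X G A x = (\<chi> \<mu> \<nu>.
     - matter_term_deriv \<epsilon> X (matrix_inv (G x)) (\<lambda>i. pd i A x) \<mu> \<nu>
     + (1/2) * G x $ \<mu> $ \<nu> * matter_term \<epsilon> X (matrix_inv (G x)) (\<lambda>i. pd i A x))"

definition field_equation ::
  "(real^11^11 \<Rightarrow> real) \<Rightarrow> (real^11 \<Rightarrow> real^11^11) \<Rightarrow> (real^11 \<Rightarrow> real) \<Rightarrow> real^11 \<Rightarrow> bool" where
  "field_equation X G A x \<longleftrightarrow>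
     (\<Sum>i\<in>{1,2}. \<Sum>j\<in>{1,2}.
        pd i (\<lambda>y. sqrt \<bar>det (G y)\<bar> * matrix_inv (G y) $ i $ j * X (matrix_inv (G y)) * pd j A y) x) = 0"

text \<open>The Einstein equations with mixed indices: \<open>matrix_inv (G x) ** S\<close> has entries \<open>S\<^sup>\<mu>\<^sub>\<nu>\<close>.\<close>

definition einstein_equations ::
  "real \<Rightarrow> (real^11^11 \<Rightarrow> real) \<Rightarrow> (real^11 \<Rightarrow> real^11^11) \<Rightarrow> (real^11 \<Rightarrow> real) \<Rightarrow>
   real^11 \<Rightarrow> bool" where
  "einstein_equations \<epsilon> X G A x \<longleftrightarrow>
     (\<forall>\<mu> \<nu>. (matrix_inv (G x) ** ricci G x) $ \<mu> $ \<nu>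
              - (1/2) * (if \<mu> = \<nu> then 1 else 0) * scalar_curvature G x
            = (matrix_inv (G x) ** energy_momentum \<epsilon> X G A x) $ \<mu> $ \<nu>)"

definition time_sign :: "11 set \<Rightarrow> real" where
  "time_sign T = (if odd (card T) then 1 else -1)"

definition xy :: "real^11 \<Rightarrow> real^2" where
  "xy x = vector [x $ 1, x $ 2]"

text \<open>Diagonal metric with time directions \<open>T\<close> and \<open>\<bar>g\<^sub>a\<^sub>a\<bar> = H\<^bsup>p a\<^esup>\<close>.\<close>

definition diag_metric :: "11 set \<Rightarrow> (11 \<Rightarrow> real) \<Rightarrow> (real^2 \<Rightarrow> real) \<Rightarrow> real^11 \<Rightarrow> real^11^11" where
  "diag_metric T p H x =
     (\<chi> a b. if a = b then (if a \<in> T then -1 else 1) * H (xy x) powr p a else 0)"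

definition solves_eom ::
  "(real^2) set \<Rightarrow> (real^2 \<Rightarrow> real) \<Rightarrow> 11 set \<Rightarrow> (11 \<Rightarrow> real) \<Rightarrow> (real^11^11 \<Rightarrow> real) \<Rightarrow> bool" where
  "solves_eom U H T p X \<longleftrightarrow>
     (let G = diag_metric T p H; A = (\<lambda>x. 1 / H (xy x)) in
      \<forall>x. xy x \<in> U \<longrightarrow> field_equation X G A x \<and> einstein_equations (time_sign T) X G A x)"

definition bracket :: "real^11^11 \<Rightarrow> real" where
  "bracket P = (\<Prod>a\<in>{3,4,5,6,7,8,9,10,11}. P $ a $ a)"

definition exps_3 :: "nat \<Rightarrow> 11 \<Rightarrow> real" where
  "exps_3 n a = (if a \<in> {1,2} then 1/3 + real n
                 else if a \<in> {3,4,5,6,7,8} then 1/3 else -2/3)"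

definition X_3 :: "nat \<Rightarrow> real^11^11 \<Rightarrow> real" where
  "X_3 n P = (\<Prod>a\<in>{9,10,11}. P $ a $ a) * bracket P ^ n"

definition times_3 :: "nat \<Rightarrow> 11 set set" where
  "times_3 n = (if even n then {{9}, {10,11}} else {{3}, {4,5,6,7,8}})"

definition exps_6 :: "nat \<Rightarrow> 11 \<Rightarrow> real" where
  "exps_6 n a = (if a \<in> {1,2} then 2/3 + real n
                 else if a \<in> {3,4,5,6,7,8} then -1/3 else 2/3)"

definition X_6 :: "nat \<Rightarrow> real^11^11 \<Rightarrow> real" where
  "X_6 n P = (\<Prod>a\<in>{3,4,5,6,7,8}. P $ a $ a) * bracket P ^ n"

definition times_6 :: "nat \<Rightarrow> 11 set set" where
  "times_6 n = (if even n then {{3}, {4,5,6,7,8}} else {{9}, {10,11}})"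

definition exps_81 :: "nat \<Rightarrow> 11 \<Rightarrow> real" where
  "exps_81 n a = (if a \<in> {1,2} then real n + 1
                  else if a = 3 then 1 else if a = 11 then -1 else 0)"

definition X_81 :: "nat \<Rightarrow> real^11^11 \<Rightarrow> real" where
  "X_81 n P = (\<Prod>a\<in>{4,5,6,7,8,9,10}. P $ a $ a) * (P $ 11 $ 11)^2 * bracket P ^ n"

definition times_81 :: "nat \<Rightarrow> 11 set set" where
  "times_81 n = (if even n then {{9,10}, {4,5,6,7,8}} else {{3}, {11}})"

end

theory Submission
  imports Defs
begin

text \<open>
  Write \<open>\<phi> = ln H\<close>, so that \<open>g\<^sub>a\<^sub>a = \<plusminus> exp (p a * \<phi>)\<close> with \<open>p 1 = p 2 = q\<close>. In all three towers
  \<open>\<Sum> p a = 2 q\<close>, and harmonicity of \<open>H\<close> reads \<open>\<Delta>\<phi> = - \<bar>\<nabla>\<phi>\<bar>\<^sup>2\<close>. The second derivatives of \<open>\<phi>\<close> then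
  drop out of the Ricci tensor, which becomes
  \<open>R\<^sup>\<mu>\<^sub>\<nu> = exp (- q \<phi>) (p \<mu> \<delta>\<^sup>\<mu>\<^sub>\<nu> \<bar>\<nabla>\<phi>\<bar>\<^sup>2 / 2 + (2 q\<^sup>2 - \<Sum> (p a)\<^sup>2) \<partial>\<^sub>\<mu>\<phi> \<partial>\<^sub>\<nu>\<phi> / 4)\<close>, with \<open>\<Sum> (p a)\<^sup>2 = 2 q\<^sup>2 + 2\<close>.
  On the matter side \<open>X = - \<epsilon> H\<^sup>2\<close>, which makes the field equation the harmonicity of \<open>H\<close>, and the
  Einstein equations reduce to \<open>p a = q - e a\<close>, where \<open>e a\<close> is the multiplicity of \<open>g\<^sup>a\<^sup>a\<close> in \<open>X\<close>.
\<close>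

section \<open>Partial derivatives\<close>

lemma pd_eqI:
  assumes "((\<lambda>t. f (x + t *\<^sub>R axis i 1)) has_real_derivative D) (at 0)"
  shows "pd i f x = D"
  using assms unfolding pd_def by (rule DERIV_imp_deriv)

lemma has_derivative_imp_DERIV_axis:
  fixes f :: "real^'n::finite \<Rightarrow> real"
  assumes "(f has_derivative f') (at x)"
  shows "((\<lambda>t. f (x + t *\<^sub>R axis i 1)) has_real_derivative f' (axis i 1)) (at 0)"
proof -
  have 1: "((\<lambda>t::real. x + t *\<^sub>R axis i 1) has_derivative (\<lambda>t. t *\<^sub>R axis i 1)) (at 0)"
    by (auto intro!: derivative_eq_intros)
  have "((\<lambda>t::real. f (x + t *\<^sub>R axis i 1)) has_derivative (\<lambda>t. f' (t *\<^sub>R axis i 1))) (at 0)"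
    by (rule has_derivative_compose[OF 1]) (use assms in simp)
  moreover have "(\<lambda>t. f' (t *\<^sub>R axis i 1)) = (*) (f' (axis i 1))"
    using linear_simps(5)[OF has_derivative_bounded_linear[OF assms]] by auto
  ultimately show ?thesis
    unfolding has_field_derivative_def by simp
qed

lemma pd_has_derivative:
  fixes f :: "real^'n::finite \<Rightarrow> real"
  assumes "(f has_derivative f') (at x)"
  shows "pd i f x = f' (axis i 1)"
  by (rule pd_eqI[OF has_derivative_imp_DERIV_axis[OF assms]])

lemma DERIV_pd:
  fixes f :: "real^'n::finite \<Rightarrow> real"
  assumes "f differentiable (at x)"
  shows "((\<lambda>t. f (x + t *\<^sub>R axis i 1)) has_real_derivative pd i f x) (at 0)"
  using assms has_derivative_imp_DERIV_axis pd_has_derivative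
  unfolding differentiable_def by metis

text \<open>The mean value theorem needs derivatives at intermediate points of a coordinate line,
  while \<open>pd\<close> always differentiates at parameter 0.\<close>

lemma DERIV_pd_shift:
  fixes f :: "real^'n::finite \<Rightarrow> real"
  assumes "f differentiable (at (x + u *\<^sub>R axis i 1))"
  shows "((\<lambda>t. f (x + t *\<^sub>R axis i 1)) has_real_derivative pd i f (x + u *\<^sub>R axis i 1)) (at u)"
proof -
  have "((\<lambda>t. f (x + (u + t) *\<^sub>R axis i 1)) has_real_derivative pd i f (x + u *\<^sub>R axis i 1)) (at 0)"
    using DERIV_pd[OF assms, of i] by (simp add: scaleR_add_left add.assoc)
  then show ?thesis
    using DERIV_shift[of "\<lambda>t. f (x + t *\<^sub>R axis i 1)" "pd i f (x + u *\<^sub>R axis i 1)" 0 u]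
    by (simp add: add.commute)
qed

text \<open>Closed formulas for the metric and for everything derived from it hold only on an open
  set. Locality of \<open>pd\<close> is what permits differentiating them there.\<close>

lemma pd_cong:
  assumes "open V" "x \<in> V" and eq: "\<And>y. y \<in> V \<Longrightarrow> f y = g y"
  shows "pd i f x = pd i g x"
proof -
  have "open ((\<lambda>t::real. x + t *\<^sub>R axis i 1) -` V)"
    by (intro open_vimage assms continuous_intros)
  then have "\<forall>\<^sub>F t in nhds (0::real). x + t *\<^sub>R axis i 1 \<in> V"
    unfolding eventually_nhds using assms(2)
    by (intro exI[of _ "(\<lambda>t::real. x + t *\<^sub>R axis i 1) -` V"]) simp
  then have "\<forall>\<^sub>F t in nhds (0::real). f (x + t *\<^sub>R axis i 1) = g (x + t *\<^sub>R axis i 1)"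
    by eventually_elim (rule eq)
  then show ?thesis
    unfolding pd_def by (rule deriv_cong_ev) simp
qed

lemma pd_const [simp]: "pd i (\<lambda>y. c) x = 0"
  unfolding pd_def by simp

text \<open>
  Young's form of the symmetry of second derivatives: the second difference quotient converges
  to the mixed derivative taken in either order.
\<close>

lemma second_difference_tendsto:
  fixes f :: "real^'n::finite \<Rightarrow> real"
  assumes V: "open V" "x \<in> V"
    and f: "\<And>y. y \<in> V \<Longrightarrow> f differentiable (at y)"
    and g: "pd i f differentiable (at x)"
  shows "((\<lambda>t. (f (x + t *\<^sub>R axis j 1 + t *\<^sub>R axis i 1) - f (x + t *\<^sub>R axis i 1)
            - f (x + t *\<^sub>R axis j 1) + f x) / t\<^sup>2) \<longlongrightarrow> pd j (pd i f) x) (at_right 0)"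
proof (rule tendstoI)
  fix e :: real assume "e > 0"
  \<comment> \<open>Linearising \<open>pd i f\<close> at \<open>x\<close> costs at most
    \<open>2 * \<epsilon> * t\<close> at the point displaced in both directions and
    \<open>\<epsilon> * t\<close> at the other one. Division by \<open>t\<close> leaves
    \<open>3 * \<epsilon> < e\<close>.\<close>
  define \<epsilon> where "\<epsilon> = e / 4"
  have "\<epsilon> > 0" using \<open>e > 0\<close> by (simp add: \<epsilon>_def)
  let ?g = "pd i f"
  let ?a = "axis i 1 :: real^'n" and ?b = "axis j 1 :: real^'n"
  obtain g' where g': "(?g has_derivative g') (at x)"
    using g unfolding differentiable_def by blast
  have L: "pd j ?g x = g' ?b" by (rule pd_has_derivative[OF g'])
  interpret g': bounded_linear g' by (rule has_derivative_bounded_linear[OF g'])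
  obtain d1 where d1: "d1 > 0"
    "\<And>y. norm (y - x) < d1 \<Longrightarrow> norm (?g y - ?g x - g' (y - x)) \<le> \<epsilon> * norm (y - x)"
    using g' \<open>\<epsilon> > 0\<close> unfolding has_derivative_at_alt by blast
  obtain d2 where d2: "d2 > 0" "ball x d2 \<subseteq> V" using V open_contains_ball by blast
  \<comment> \<open>The displacements have norm at most \<open>2 * t\<close>, so halving keeps them
    inside both balls.\<close>
  define d where "d = min d1 d2 / 2"
  have "d > 0" using d1 d2 by (simp add: d_def)
  have "dist ((f (x + t *\<^sub>R ?b + t *\<^sub>R ?a) - f (x + t *\<^sub>R ?a)
            - f (x + t *\<^sub>R ?b) + f x) / t\<^sup>2) (pd j ?g x) < e" if t: "0 < t" "t < d" for t
  proof -
    have nrm: "norm (u *\<^sub>R ?a + v *\<^sub>R ?b) \<le> \<bar>u\<bar> + \<bar>v\<bar>" for u v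
      using norm_triangle_ineq[of "u *\<^sub>R ?a" "v *\<^sub>R ?b"] by simp
    have inV: "x + v *\<^sub>R ?b + u *\<^sub>R ?a \<in> V" if "0 \<le> u" "u \<le> t" "0 \<le> v" "v \<le> t" for u v
    proof -
      have "norm (u *\<^sub>R ?a + v *\<^sub>R ?b) < d2" using nrm[of u v] that t d_def by linarith
      moreover have "x - (x + v *\<^sub>R ?b + u *\<^sub>R ?a) = - (u *\<^sub>R ?a + v *\<^sub>R ?b)" by simp
      ultimately have "x + v *\<^sub>R ?b + u *\<^sub>R ?a \<in> ball x d2"
        unfolding mem_ball dist_norm by (metis norm_minus_cancel)
      then show ?thesis using d2 by blast
    qed
    \<comment> \<open>\<open>h\<close> is the difference of \<open>f\<close> in direction
      \<open>j\<close>, as a function of the displacement in direction \<open>i\<close>. The second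
      difference is \<open>h t - h 0\<close>, and the mean value theorem turns it into a difference
      of values of \<open>pd i f\<close>.\<close>
    define h where "h = (\<lambda>u. f (x + t *\<^sub>R ?b + u *\<^sub>R ?a) - f (x + u *\<^sub>R ?a))"
    have h': "(h has_real_derivative ?g (x + t *\<^sub>R ?b + u *\<^sub>R ?a) - ?g (x + u *\<^sub>R ?a)) (at u)"
      if "0 \<le> u" "u \<le> t" for u
      unfolding h_def
      by (intro DERIV_diff DERIV_pd_shift f)
        (use inV[of u t] inV[of u 0] that t in simp_all)
    obtain z where z: "0 < z" "z < t"
      "h t - h 0 = (t - 0) * (?g (x + t *\<^sub>R ?b + z *\<^sub>R ?a) - ?g (x + z *\<^sub>R ?a))"
      using MVT2[OF t(1), of h "\<lambda>u. ?g (x + t *\<^sub>R ?b + u *\<^sub>R ?a) - ?g (x + u *\<^sub>R ?a)"] h' by blast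
    have lt: "norm (z *\<^sub>R ?a + t *\<^sub>R ?b) \<le> 2 * t" "norm (z *\<^sub>R ?a + 0 *\<^sub>R ?b) \<le> t"
      using nrm[of z t] nrm[of z 0] z t by auto
    \<comment> \<open>Both values of \<open>pd i f\<close> are expanded at the same point
      \<open>x\<close>. In their difference the unknown contribution of \<open>z\<close> cancels and
      \<open>t * g' ?b\<close> remains.\<close>
    have "\<bar>?g (x + t *\<^sub>R ?b + z *\<^sub>R ?a) - ?g x - g' (z *\<^sub>R ?a + t *\<^sub>R ?b)\<bar>
        \<le> \<epsilon> * norm (z *\<^sub>R ?a + t *\<^sub>R ?b)"
      using d1(2)[of "x + t *\<^sub>R ?b + z *\<^sub>R ?a"] lt t d_def by (simp add: algebra_simps)
    moreover have "\<bar>?g (x + z *\<^sub>R ?a) - ?g x - g' (z *\<^sub>R ?a)\<bar> \<le> \<epsilon> * norm (z *\<^sub>R ?a)"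
      using d1(2)[of "x + z *\<^sub>R ?a"] lt t d_def by (simp add: algebra_simps)
    moreover have "\<epsilon> * norm (z *\<^sub>R ?a + t *\<^sub>R ?b) \<le> \<epsilon> * (2 * t)" "\<epsilon> * norm (z *\<^sub>R ?a) \<le> \<epsilon> * t"
      using lt \<open>\<epsilon> > 0\<close> by (intro mult_left_mono; simp)+
    ultimately have "\<bar>?g (x + t *\<^sub>R ?b + z *\<^sub>R ?a) - ?g (x + z *\<^sub>R ?a) - t * g' ?b\<bar> \<le> 3 * \<epsilon> * t"
      by (simp add: g'.add g'.scaleR abs_le_iff algebra_simps)
    then have "\<bar>(?g (x + t *\<^sub>R ?b + z *\<^sub>R ?a) - ?g (x + z *\<^sub>R ?a) - t * g' ?b) / t\<bar> \<le> 3 * \<epsilon>"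
      using t by (simp add: abs_divide divide_le_eq)
    also have "3 * \<epsilon> < e" using \<open>e > 0\<close> by (simp add: \<epsilon>_def)
    also have "(?g (x + t *\<^sub>R ?b + z *\<^sub>R ?a) - ?g (x + z *\<^sub>R ?a) - t * g' ?b) / t
        = (h t - h 0) / t\<^sup>2 - g' ?b"
      using t by (simp add: z(3) field_simps power2_eq_square)
    also have "h t - h 0 = f (x + t *\<^sub>R ?b + t *\<^sub>R ?a) - f (x + t *\<^sub>R ?a) - f (x + t *\<^sub>R ?b) + f x"
      by (simp add: h_def)
    finally show ?thesis by (simp add: dist_real_def L)
  qed
  then show "\<forall>\<^sub>F t in at_right 0. dist ((f (x + t *\<^sub>R ?b + t *\<^sub>R ?a) - f (x + t *\<^sub>R ?a)
            - f (x + t *\<^sub>R ?b) + f x) / t\<^sup>2) (pd j ?g x) < e"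
    unfolding eventually_at_right_field using \<open>d > 0\<close> by blast
qed

text \<open>The second difference is symmetric in \<open>i\<close> and \<open>j\<close>, so both
  mixed derivatives are limits of the same quotient.\<close>

lemma pd_commute:
  fixes f :: "real^'n::finite \<Rightarrow> real"
  assumes V: "open V" "x \<in> V"
    and f: "\<And>y. y \<in> V \<Longrightarrow> f differentiable (at y)"
    and g: "\<And>i. pd i f differentiable (at x)"
  shows "pd j (pd i f) x = pd i (pd j f) x"
proof -
  have "x + t *\<^sub>R axis i 1 + t *\<^sub>R axis j 1 = x + t *\<^sub>R axis j 1 + t *\<^sub>R axis i 1" for t
    by (simp add: algebra_simps)
  then have "((\<lambda>t. (f (x + t *\<^sub>R axis j 1 + t *\<^sub>R axis i 1) - f (x + t *\<^sub>R axis i 1)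
            - f (x + t *\<^sub>R axis j 1) + f x) / t\<^sup>2) \<longlongrightarrow> pd i (pd j f) x) (at_right 0)"
    using second_difference_tendsto[OF V f g, of i j] by (simp add: algebra_simps)
  then show ?thesis
    using second_difference_tendsto[OF V f g, of j i] tendsto_unique trivial_limit_at_right_real
    by blast
qed

section \<open>Diagonal metrics whose components are powers of one function\<close>

lemma matrix_inv_unique:
  fixes A B :: "'a::semiring_1^'n^'n"
  assumes "A ** B = mat 1" "B ** A = mat 1"
  shows "matrix_inv A = B"
proof -
  have "A ** matrix_inv A = mat 1 \<and> matrix_inv A ** A = mat 1"
    unfolding matrix_inv_def by (rule someI[of _ B]) (use assms in blast)
  then have "B ** (A ** matrix_inv A) = B ** mat 1" by metis
  then show ?thesis unfolding matrix_mul_assoc assms by (simp)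
qed

lemma matrix_inv_diagonal:
  fixes d :: "'n::finite \<Rightarrow> real"
  assumes "\<And>a. d a \<noteq> 0"
  shows "matrix_inv (\<chi> a b. if a = b then d a else 0) = (\<chi> a b. if a = b then 1 / d a else 0)"
  by (rule matrix_inv_unique)
    (auto simp: matrix_matrix_mult_def mat_def vec_eq_iff assms if_distrib[of "\<lambda>x. x * _"]
      if_distrib[of "\<lambda>x. _ * x"] cong: if_cong)

lemma sum_delta_mult:
  fixes f g :: "'n::finite \<Rightarrow> real"
  shows "(\<Sum>l\<in>UNIV. (if a = l then f l else 0) * g l) = f a * g a"
    and "(\<Sum>l\<in>UNIV. (if l = a then f l else 0) * g l) = f a * g a"
  by (simp_all add: if_distrib[of "\<lambda>x. x * _"] cong: if_cong)

text \<open>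
  The condition \<open>lap\<close> says that \<open>exp \<phi>\<close> is harmonic. The coordinates in \<open>B\<close> are the ones on which
  \<open>\<phi>\<close> depends, and \<open>sum_p\<close> makes them harmonic, that is \<open>\<surd>\<bar>g\<bar> g\<^sup>i\<^sup>i = 1\<close> for \<open>i \<in> B\<close>.
\<close>

locale exp_diag_metric =
  fixes V :: "(real^'n::finite) set" and \<phi> :: "real^'n \<Rightarrow> real"
    and G :: "real^'n \<Rightarrow> real^'n^'n"
    and s p :: "'n \<Rightarrow> real" and B :: "'n set" and q :: real
  assumes open_V: "open V"
    and diff: "\<And>x. x \<in> V \<Longrightarrow> \<phi> differentiable (at x)"
    and diff_pd: "\<And>x i. x \<in> V \<Longrightarrow> pd i \<phi> differentiable (at x)"
    and s_square: "\<And>a. s a * s a = 1"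
    and s_B: "\<And>a. a \<in> B \<Longrightarrow> s a = 1"
    and p_B: "\<And>a. a \<in> B \<Longrightarrow> p a = q"
    and pd_outside: "\<And>a x. x \<in> V \<Longrightarrow> a \<notin> B \<Longrightarrow> pd a \<phi> x = 0"
    and lap: "\<And>x. x \<in> V \<Longrightarrow> (\<Sum>i\<in>UNIV. pd i (pd i \<phi>) x) = - (\<Sum>i\<in>UNIV. (pd i \<phi> x)\<^sup>2)"
    and sum_p: "sum p UNIV = 2 * q"
    and G: "\<And>x. x \<in> V \<Longrightarrow> G x = (\<chi> a b. if a = b then s a * exp (p a * \<phi> x) else 0)"
begin

text \<open>The product \<open>c a x * pd l \<phi> x\<close> is the inverse metric entry at
  \<open>l\<close> times the \<open>l\<close>-derivative of the metric entry at \<open>a\<close>,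
  for every \<open>l\<close>: on \<open>B\<close> that inverse entry is
  \<open>exp (- q * \<phi> x)\<close>, and elsewhere the derivative of \<open>\<phi>\<close>
  vanishes.\<close>

definition c :: "'n \<Rightarrow> real^'n \<Rightarrow> real" where
  "c a x = s a * p a * exp ((p a - q) * \<phi> x)"

definition N :: "real^'n \<Rightarrow> real" where
  "N x = (\<Sum>i\<in>UNIV. (pd i \<phi> x)\<^sup>2)"

lemma inverse_s: "1 / s a = s a"
  using s_square[of a] by (auto simp: divide_eq_eq)

lemma inv_G:
  assumes "x \<in> V"
  shows "matrix_inv (G x) = (\<chi> a b. if a = b then s a * exp (- p a * \<phi> x) else 0)"
proof -
  have nz: "s a * exp (p a * \<phi> x) \<noteq> 0" for a
    using s_square[of a] by auto
  have "1 / (s a * exp (p a * \<phi> x)) = s a * exp (- p a * \<phi> x)" for a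
    using inverse_s[of a] by (simp add: exp_minus field_simps)
  then show ?thesis
    unfolding G[OF assms] matrix_inv_diagonal[of "\<lambda>a. s a * exp (p a * \<phi> x)", OF nz]
    by (simp only:)
qed

lemma DERIV_\<phi>:
  assumes "x \<in> V"
  shows "((\<lambda>t. \<phi> (x + t *\<^sub>R axis i 1)) has_real_derivative pd i \<phi> x) (at 0)"
    and "((\<lambda>t. pd j \<phi> (x + t *\<^sub>R axis i 1)) has_real_derivative pd i (pd j \<phi>) x) (at 0)"
  by (intro DERIV_pd diff diff_pd assms)+

lemma pd_pd_commute:
  assumes "x \<in> V" shows "pd i (pd j \<phi>) x = pd j (pd i \<phi>) x"
  by (rule pd_commute[OF open_V assms diff diff_pd[OF assms]])

lemma pd_pd_outside:
  assumes "x \<in> V" "a \<notin> B" shows "pd i (pd a \<phi>) x = 0"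
  using pd_cong[OF open_V assms(1), of "pd a \<phi>" "\<lambda>_. 0" i] pd_outside assms(2) by simp

text \<open>On \<open>B\<close> the exponent is \<open>q\<close>, and off \<open>B\<close> both
  sides vanish. Next to a matching derivative of \<open>\<phi>\<close>, exponents can therefore be
  replaced by \<open>q\<close>; the same split serves for \<open>c\<close>, which is the constant
  \<open>q\<close> on \<open>B\<close>.\<close>

lemma p_pd [simp]:
  assumes "x \<in> V"
  shows "p a * pd a \<phi> x = q * pd a \<phi> x" and "p a * pd i (pd a \<phi>) x = q * pd i (pd a \<phi>) x"
  using pd_outside[OF assms, of a] pd_pd_outside[OF assms, of a i] p_B[of a]
  by (cases "a \<in> B"; simp)+

lemma c_pd [simp]:
  assumes "x \<in> V"
  shows "c a x * pd a \<phi> x = q * pd a \<phi> x" and "c a x * pd i (pd a \<phi>) x = q * pd i (pd a \<phi>) x"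
  using pd_outside[OF assms, of a] pd_pd_outside[OF assms, of a i] p_B[of a] s_B[of a]
  by (cases "a \<in> B"; simp add: c_def)+

section \<open>Christoffel symbols and their contractions\<close>

lemma pd_G:
  assumes "x \<in> V"
  shows "pd i (\<lambda>y. G y $ a $ b) x
    = (if a = b then s a * p a * exp (p a * \<phi> x) * pd i \<phi> x else 0)"
proof -
  have "pd i (\<lambda>y. G y $ a $ b) x
      = pd i (\<lambda>y. if a = b then s a * exp (p a * \<phi> y) else 0) x"
    by (rule pd_cong[OF open_V assms]) (simp add: G)
  also have "\<dots> = (if a = b then s a * p a * exp (p a * \<phi> x) * pd i \<phi> x else 0)"
    by (cases "a = b") (auto intro!: pd_eqI derivative_eq_intros DERIV_\<phi> assms)
  finally show ?thesis .
qed

lemma christoffel_eq: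
  assumes "x \<in> V"
  shows "christoffel G l m k x = 1/2 * ((if l = k then p l * pd m \<phi> x else 0)
    + (if l = m then p l * pd k \<phi> x else 0) - (if m = k then c m x * pd l \<phi> x else 0))"
proof -
  have 1: "s l * exp (- p l * \<phi> x) * (s l * p l * exp (p l * \<phi> x) * y) = p l * y" for y
    using s_square[of l] by (simp add: exp_minus field_simps)
  have 2: "s l * exp (- p l * \<phi> x) * (s m * p m * exp (p m * \<phi> x) * pd l \<phi> x)
      = c m x * pd l \<phi> x"
    using pd_outside[OF assms, of l] p_B[of l] s_B[of l]
    by (cases "l \<in> B") (auto simp: c_def left_diff_distrib exp_diff exp_minus field_simps)
  have "christoffel G l m k x = 1/2 * (s l * exp (- p l * \<phi> x) *
      (pd m (\<lambda>y. G y $ l $ k) x + pd k (\<lambda>y. G y $ l $ m) x - pd l (\<lambda>y. G y $ m $ k) x))"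
    unfolding christoffel_def inv_G[OF assms] by (simp add: sum_delta_mult)
  also have "\<dots> = 1/2 * ((if l = k then s l * exp (- p l * \<phi> x) * (s l * p l * exp (p l * \<phi> x) * pd m \<phi> x) else 0)
    + (if l = m then s l * exp (- p l * \<phi> x) * (s l * p l * exp (p l * \<phi> x) * pd k \<phi> x) else 0)
    - (if m = k then s l * exp (- p l * \<phi> x) * (s m * p m * exp (p m * \<phi> x) * pd l \<phi> x) else 0))"
    unfolding pd_G[OF assms] by (simp add: distrib_left right_diff_distrib)
  finally show ?thesis unfolding 1 2 .
qed

lemma pd_christoffel:
  assumes "x \<in> V"
  shows "pd i (christoffel G l m k) x = 1/2 * ((if l = k then p l * pd i (pd m \<phi>) x else 0)
    + (if l = m then p l * pd i (pd k \<phi>) x else 0)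
    - (if m = k then (p m - q) * c m x * pd i \<phi> x * pd l \<phi> x + c m x * pd i (pd l \<phi>) x else 0))"
proof -
  have "pd i (christoffel G l m k) x = pd i (\<lambda>y. 1/2 * ((if l = k then p l * pd m \<phi> y else 0)
    + (if l = m then p l * pd k \<phi> y else 0) - (if m = k then c m y * pd l \<phi> y else 0))) x"
    by (rule pd_cong[OF open_V assms]) (rule christoffel_eq)
  also have "\<dots> = 1/2 * ((if l = k then p l * pd i (pd m \<phi>) x else 0)
    + (if l = m then p l * pd i (pd k \<phi>) x else 0)
    - (if m = k then (p m - q) * c m x * pd i \<phi> x * pd l \<phi> x + c m x * pd i (pd l \<phi>) x else 0))"
  proof (rule pd_eqI, intro DERIV_cmult DERIV_diff DERIV_add)
    \<comment> \<open>The two Kronecker terms containing \<open>p l\<close> have the same shape, so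
      one statement generic in \<open>a\<close>, \<open>b\<close> and \<open>j\<close> is shown once
      for each.\<close>
    fix a b j
    show "((\<lambda>t. if a = b then p l * pd j \<phi> (x + t *\<^sub>R axis i 1) else 0) has_real_derivative
        (if a = b then p l * pd i (pd j \<phi>) x else 0)) (at 0)"
      by (cases "a = b") (auto intro!: derivative_eq_intros DERIV_\<phi> assms)
    then show "((\<lambda>t. if a = b then p l * pd j \<phi> (x + t *\<^sub>R axis i 1) else 0) has_real_derivative
        (if a = b then p l * pd i (pd j \<phi>) x else 0)) (at 0)" .
    show "((\<lambda>t. if m = k then c m (x + t *\<^sub>R axis i 1) * pd l \<phi> (x + t *\<^sub>R axis i 1) else 0)
        has_real_derivative (if m = k then (p m - q) * c m x * pd i \<phi> x * pd l \<phi> x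
          + c m x * pd i (pd l \<phi>) x else 0)) (at 0)"
      unfolding c_def
      by (cases "m = k")
        (auto intro!: derivative_eq_intros DERIV_\<phi> assms simp: algebra_simps)
  qed
  finally show ?thesis .
qed

text \<open>In a product of two Christoffel symbols the second one is taken as \<open>y\<close>.
  Only one factor then has to be expanded.\<close>

lemma sum_christoffel_mult:
  assumes "x \<in> V"
  shows "(\<Sum>l\<in>UNIV. christoffel G r k l x * y l) = 1/2 * (p r * pd k \<phi> x * y r
    + (if r = k then p k * (\<Sum>l\<in>UNIV. pd l \<phi> x * y l) else 0) - c k x * pd r \<phi> x * y k)"
proof -
  have "(\<Sum>l\<in>UNIV. christoffel G r k l x * y l)
      = (\<Sum>l\<in>UNIV. 1/2 * ((if r = l then p r * pd k \<phi> x else 0) * y l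
        + (if r = k then p k * (pd l \<phi> x * y l) else 0)
        - (if k = l then c k x * pd r \<phi> x else 0) * y l))"
    by (rule sum.cong) (simp_all add: christoffel_eq[OF assms] algebra_simps)
  also have "\<dots> = 1/2 * ((\<Sum>l\<in>UNIV. (if r = l then p r * pd k \<phi> x else 0) * y l)
      + (\<Sum>l\<in>UNIV. (if r = k then p k * (pd l \<phi> x * y l) else 0))
      - (\<Sum>l\<in>UNIV. (if k = l then c k x * pd r \<phi> x else 0) * y l))"
    by (simp only: sum_distrib_left[symmetric] sum.distrib sum_subtractf)
  also have "(\<Sum>l\<in>UNIV. (if r = k then p k * (pd l \<phi> x * y l) else 0))
      = (if r = k then p k * (\<Sum>l\<in>UNIV. pd l \<phi> x * y l) else 0)"
    by (simp add: sum_distrib_left)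
  finally show ?thesis by (simp only: sum_delta_mult)
qed

text \<open>This contraction appears both as the middle term of \<open>sum_christoffel_mult\<close>
  and, through \<open>christoffel_diag\<close>, in the trace part of the Ricci tensor.\<close>

lemma sum_pd_christoffel:
  assumes "x \<in> V"
  shows "(\<Sum>l\<in>UNIV. pd l \<phi> x * christoffel G l r m x)
    = 1/2 * (2 * q * pd r \<phi> x * pd m \<phi> x - (if r = m then c r x * N x else 0))"
proof -
  have "(\<Sum>l\<in>UNIV. pd l \<phi> x * christoffel G l r m x)
      = (\<Sum>l\<in>UNIV. 1/2 * ((if l = m then p l * pd r \<phi> x else 0) * pd l \<phi> x
        + (if l = r then p l * pd m \<phi> x else 0) * pd l \<phi> x
        - (if r = m then c r x * (pd l \<phi> x)\<^sup>2 else 0)))"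
    by (rule sum.cong) (simp_all add: christoffel_eq[OF assms] algebra_simps power2_eq_square)
  also have "\<dots> = 1/2 * ((\<Sum>l\<in>UNIV. (if l = m then p l * pd r \<phi> x else 0) * pd l \<phi> x)
      + (\<Sum>l\<in>UNIV. (if l = r then p l * pd m \<phi> x else 0) * pd l \<phi> x)
      - (\<Sum>l\<in>UNIV. if r = m then c r x * (pd l \<phi> x)\<^sup>2 else 0))"
    by (simp only: sum_distrib_left[symmetric] sum.distrib sum_subtractf)
  also have "(\<Sum>l\<in>UNIV. if r = m then c r x * (pd l \<phi> x)\<^sup>2 else 0)
      = (if r = m then c r x * N x else 0)"
    by (simp add: N_def sum_distrib_left)
  also have "(\<Sum>l\<in>UNIV. (if l = m then p l * pd r \<phi> x else 0) * pd l \<phi> x)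
      = q * pd r \<phi> x * pd m \<phi> x"
    using p_pd(1)[OF assms, of m] by (simp only: sum_delta_mult) (auto simp: algebra_simps)
  also have "(\<Sum>l\<in>UNIV. (if l = r then p l * pd m \<phi> x else 0) * pd l \<phi> x)
      = q * pd r \<phi> x * pd m \<phi> x"
    using p_pd(1)[OF assms, of r] by (simp only: sum_delta_mult) (auto simp: algebra_simps)
  finally show ?thesis by (simp add: algebra_simps)
qed

text \<open>For \<open>r = m\<close> the first and third terms of \<open>christoffel_eq\<close>
  cancel, since \<open>p\<close> and \<open>c\<close> both act as \<open>q\<close> on the derivative
  of \<open>\<phi>\<close>.\<close>

lemma christoffel_diag:
  assumes "x \<in> V"
  shows "christoffel G r r m x = 1/2 * p r * pd m \<phi> x"
  using p_pd(1)[OF assms, of m] c_pd(1)[OF assms, of m]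
  by (auto simp: christoffel_eq[OF assms])

lemma sum_christoffel_square:
  assumes "x \<in> V"
  shows "(\<Sum>r\<in>UNIV. \<Sum>l\<in>UNIV. christoffel G r k l x * christoffel G l r m x)
    = 1/4 * (((\<Sum>a\<in>UNIV. (p a)\<^sup>2) + 2 * q\<^sup>2) * pd k \<phi> x * pd m \<phi> x
        - (if k = m then 2 * p k * c k x * N x else 0))"
proof -
  let ?f = "\<lambda>a. pd a \<phi> x"
  note pf = p_pd(1)[OF assms] and cf = c_pd(1)[OF assms]
  \<comment> \<open>For fixed \<open>r\<close> the result is arranged so that the sum over
    \<open>r\<close> involves only squares of \<open>p\<close>, squares of the gradient and
    Kronecker deltas. The last two deltas cancel only after that sum.\<close>
  have "(\<Sum>l\<in>UNIV. christoffel G r k l x * christoffel G l r m x)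
    = 1/4 * ((p r)\<^sup>2 * (?f k * ?f m)
        + (if r = k then p k * (2 * q * ?f k * ?f m - (if k = m then c k x * N x else 0)) else 0)
        - (if k = m then p k * c k x else 0) * (?f r)\<^sup>2
        - (if r = k then q * q * ?f k * ?f m else 0)
        + (if r = m then q * q * ?f k * ?f m else 0))" (is "_ = ?t r") for r
  proof -
    have C: "christoffel G k r m x = 1/2 * ((if k = m then p k * ?f r else 0)
        + (if r = k then p k * ?f m else 0) - (if r = m then c r x * ?f k else 0))"
      by (simp add: christoffel_eq[OF assms] eq_commute[of r k])
    have products: "p k * ?f k = q * ?f k" "p m * ?f m = q * ?f m" "c k x * ?f k = q * ?f k"
      "c m x * ?f m = q * ?f m"
      by (rule pf cf)+
    \<comment> \<open>The Groebner basis method does not cope with fractions.\<close>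
    define h :: real where "h = 1/2"
    have h: "1/2 = h" "1/4 = h * h" by (simp_all add: h_def)
    note expand = sum_christoffel_mult[OF assms] sum_pd_christoffel[OF assms]
        christoffel_diag[OF assms] C h
    consider "r = k" "k = m" | "r = k" "k \<noteq> m" | "r \<noteq> k" "r = m" "k \<noteq> m"
      | "r \<noteq> k" "r \<noteq> m" "k = m" | "r \<noteq> k" "r \<noteq> m" "k \<noteq> m"
      by auto
    then show ?thesis
    proof cases
      case 1
      show ?thesis
        unfolding expand by (simp only: 1 if_True if_False refl) (use products in algebra)
    next
      case 2
      show ?thesis
        unfolding expand by (simp only: 2 if_True if_False refl) (use products in algebra)
    next
      case 3
      show ?thesis
        unfolding expand
        by (simp only: 3 eq_commute[of m k] if_True if_False refl) (use products in algebra)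
    next
      case 4
      show ?thesis
        unfolding expand by (simp add: 4 algebra_simps power2_eq_square)
    next
      case 5
      show ?thesis
        unfolding expand by (simp add: 5 algebra_simps power2_eq_square)
    qed
  qed
  then have "(\<Sum>r\<in>UNIV. \<Sum>l\<in>UNIV. christoffel G r k l x * christoffel G l r m x)
      = (\<Sum>r\<in>UNIV. ?t r)" by (intro sum.cong refl)
  also have "\<dots> = 1/4 * ((\<Sum>r\<in>UNIV. (p r)\<^sup>2) * (?f k * ?f m)
        + p k * (2 * q * ?f k * ?f m - (if k = m then c k x * N x else 0))
        - (if k = m then p k * c k x else 0) * N x
        - q * q * ?f k * ?f m + q * q * ?f k * ?f m)"
    by (simp only: sum_distrib_left[symmetric] sum_distrib_right[symmetric] sum.distrib
        sum_subtractf N_def sum.delta[OF finite_class.finite_UNIV] UNIV_I if_True)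
  also have "\<dots> = 1/4 * (((\<Sum>a\<in>UNIV. (p a)\<^sup>2) + 2 * q\<^sup>2) * ?f k * ?f m
        - (if k = m then 2 * p k * c k x * N x else 0))"
    using pf[of k] by (auto simp: algebra_simps power2_eq_square)
  finally show ?thesis .
qed

text \<open>The traced symbol is the derivative of the logarithm of the volume density, and
  \<open>sum_p\<close> makes this logarithm \<open>q * \<phi>\<close>.\<close>

lemma sum_pd_christoffel_trace:
  assumes "x \<in> V"
  shows "(\<Sum>r\<in>UNIV. pd k (christoffel G r r m) x) = q * pd k (pd m \<phi>) x"
proof -
  have "pd k (christoffel G r r m) x = pd k (\<lambda>y. 1/2 * p r * pd m \<phi> y) x" for r
    by (rule pd_cong[OF open_V assms]) (rule christoffel_diag)
  moreover have "pd k (\<lambda>y. 1/2 * p r * pd m \<phi> y) x = p r * (1/2 * pd k (pd m \<phi>) x)" for r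
    by (rule pd_eqI) (auto intro!: derivative_eq_intros DERIV_\<phi> assms)
  ultimately show ?thesis
    using sum_p by (simp add: sum_distrib_right[symmetric] del: times_divide_eq_right)
qed

text \<open>Harmonicity enters here: \<open>lap\<close> replaces the Laplacian of
  \<open>\<phi>\<close> by \<open>- N x\<close>, which shifts the factor \<open>p k - q\<close> to
  \<open>p k - q - 1\<close>.\<close>

lemma sum_pd_christoffel_div:
  assumes "x \<in> V"
  shows "(\<Sum>r\<in>UNIV. pd r (christoffel G r k m) x)
    = q * pd k (pd m \<phi>) x - (if k = m then 1/2 * (p k - q - 1) * c k x * N x else 0)"
proof -
  have "(\<Sum>r\<in>UNIV. pd r (christoffel G r k m) x)
    = (\<Sum>r\<in>UNIV. 1/2 * ((if r = m then p r * pd r (pd k \<phi>) x else 0)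
      + (if r = k then p r * pd r (pd m \<phi>) x else 0)
      - (if k = m then (p k - q) * c k x else 0) * (pd r \<phi> x)\<^sup>2
      - (if k = m then c k x else 0) * pd r (pd r \<phi>) x))"
    by (rule sum.cong) (simp_all add: pd_christoffel[OF assms] algebra_simps power2_eq_square)
  also have "\<dots> = 1/2 * (p m * pd m (pd k \<phi>) x + p k * pd k (pd m \<phi>) x
      - (if k = m then (p k - q) * c k x else 0) * N x - (if k = m then c k x else 0) * (- N x))"
    by (simp only: sum_distrib_left[symmetric] sum_distrib_right[symmetric] sum.distrib
        sum_subtractf N_def lap[OF assms] sum.delta[OF finite_class.finite_UNIV] UNIV_I if_True)
  also have "\<dots> = q * pd k (pd m \<phi>) x
      - (if k = m then 1/2 * (p k - q - 1) * c k x * N x else 0)"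
    using p_pd(2)[OF assms, of m k] p_pd(2)[OF assms, of k m]
    by (auto simp: field_simps pd_pd_commute[OF assms, of k m])
  finally show ?thesis .
qed

section \<open>Ricci tensor, scalar curvature and volume density\<close>

text \<open>The second derivatives in divergence and trace are both
  \<open>q * pd k (pd m \<phi>) x\<close> and cancel. In the coefficient of
  \<open>c k x * N x\<close> the contributions of \<open>p k\<close> and \<open>q\<close> cancel as
  well, leaving the 1/2 that came from harmonicity.\<close>

lemma ricci_eq:
  assumes "x \<in> V"
  shows "ricci G x $ m $ k = (if m = k then 1/2 * c k x * N x else 0)
    + 1/4 * (2 * q\<^sup>2 - (\<Sum>a\<in>UNIV. (p a)\<^sup>2)) * pd m \<phi> x * pd k \<phi> x"
proof -
  have "(\<Sum>r\<in>UNIV. \<Sum>l\<in>UNIV. christoffel G r r l x * christoffel G l k m x)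
      = (\<Sum>r\<in>UNIV. p r * (1/2 * (\<Sum>l\<in>UNIV. pd l \<phi> x * christoffel G l k m x)))"
    by (simp add: christoffel_diag[OF assms] sum_distrib_left sum_divide_distrib mult_ac)
  also have "\<dots> = q * (\<Sum>l\<in>UNIV. pd l \<phi> x * christoffel G l k m x)"
    using sum_p by (simp only: sum_distrib_right[symmetric])
  finally have 1: "(\<Sum>r\<in>UNIV. \<Sum>l\<in>UNIV. christoffel G r r l x * christoffel G l k m x)
      = q * (1/2 * (2 * q * pd k \<phi> x * pd m \<phi> x - (if k = m then c k x * N x else 0)))"
    by (simp only: sum_pd_christoffel[OF assms])
  have "ricci G x $ m $ k = (\<Sum>r\<in>UNIV. pd r (christoffel G r k m) x)
      - (\<Sum>r\<in>UNIV. pd k (christoffel G r r m) x)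
      + (\<Sum>r\<in>UNIV. \<Sum>l\<in>UNIV. christoffel G r r l x * christoffel G l k m x)
      - (\<Sum>r\<in>UNIV. \<Sum>l\<in>UNIV. christoffel G r k l x * christoffel G l r m x)"
    unfolding ricci_def riemann_def by (simp add: sum.distrib sum_subtractf)
  then show ?thesis
    unfolding 1 sum_pd_christoffel_div[OF assms] sum_pd_christoffel_trace[OF assms]
      sum_christoffel_square[OF assms]
    by (auto simp: field_simps power2_eq_square)
qed

lemma ricci_mixed:
  assumes "x \<in> V"
  shows "(matrix_inv (G x) ** ricci G x) $ m $ k = exp (- q * \<phi> x) *
    ((if m = k then 1/2 * p k * N x else 0)
      + 1/4 * (2 * q\<^sup>2 - (\<Sum>a\<in>UNIV. (p a)\<^sup>2)) * pd m \<phi> x * pd k \<phi> x)"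
proof -
  have 1: "s m * exp (- p m * \<phi> x) * pd m \<phi> x = exp (- q * \<phi> x) * pd m \<phi> x"
    using pd_outside[OF assms, of m] p_B[of m] s_B[of m] by (cases "m \<in> B") auto
  have 2: "s m * exp (- p m * \<phi> x) * c m x = exp (- q * \<phi> x) * p m"
    using s_square[of m]
    by (simp add: c_def left_diff_distrib exp_diff exp_minus field_simps)
  have "(matrix_inv (G x) ** ricci G x) $ m $ k = s m * exp (- p m * \<phi> x) * ricci G x $ m $ k"
    by (simp add: inv_G[OF assms] matrix_matrix_mult_def sum_delta_mult)
  also have "\<dots> = (if m = k then 1/2 * (s m * exp (- p m * \<phi> x) * c m x) * N x else 0)
    + 1/4 * (2 * q\<^sup>2 - (\<Sum>a\<in>UNIV. (p a)\<^sup>2)) * (s m * exp (- p m * \<phi> x) * pd m \<phi> x) * pd k \<phi> x"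
    by (simp add: ricci_eq[OF assms] algebra_simps)
  finally show ?thesis unfolding 1 2 by (simp add: algebra_simps)
qed

lemma scalar_curvature_eq:
  assumes "x \<in> V"
  shows "scalar_curvature G x
    = exp (- q * \<phi> x) * (q + 1/4 * (2 * q\<^sup>2 - (\<Sum>a\<in>UNIV. (p a)\<^sup>2))) * N x"
proof -
  let ?r = "1/4 * (2 * q\<^sup>2 - (\<Sum>a\<in>UNIV. (p a)\<^sup>2))"
  \<comment> \<open>The definition contracts both matrices in the same index order, whereas the
    trace of the matrix product transposes one of them.\<close>
  have sym: "ricci G x $ m $ k = ricci G x $ k $ m" for m k
    by (auto simp: ricci_eq[OF assms])
  have "scalar_curvature G x = (\<Sum>m\<in>UNIV. (matrix_inv (G x) ** ricci G x) $ m $ m)"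
    unfolding scalar_curvature_def matrix_matrix_mult_def
    by (simp add: sym[of _ m for m])
  also have "\<dots> = (\<Sum>m\<in>UNIV. exp (- q * \<phi> x) * (p m * (1/2 * N x) + ?r * (pd m \<phi> x)\<^sup>2))"
    by (simp add: ricci_mixed[OF assms] power2_eq_square mult_ac)
  also have "\<dots> = exp (- q * \<phi> x) * (sum p UNIV * (1/2 * N x) + ?r * N x)"
    by (simp only: N_def sum.distrib sum_distrib_left[symmetric] sum_distrib_right[symmetric])
  finally show ?thesis using sum_p by (simp add: algebra_simps)
qed

lemma sqrt_det_G:
  assumes "x \<in> V"
  shows "sqrt \<bar>det (G x)\<bar> = exp (q * \<phi> x)"
proof -
  have "\<bar>s a\<bar> = 1" for a
    using s_square[of a] by (simp add: power2_eq_square flip: abs_square_eq_1)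
  then have "\<bar>det (G x)\<bar> = exp (2 * (q * \<phi> x))"
    using sum_p by (simp add: G[OF assms] det_diagonal abs_prod abs_mult exp_sum[symmetric]
        sum_distrib_right[symmetric])
  also have "\<dots> = (exp (q * \<phi> x))\<^sup>2" by (simp add: exp_double)
  finally show ?thesis by simp
qed

end

section \<open>The towers\<close>

lemma UNIV_11: "(UNIV :: 11 set) = {1,2,3,4,5,6,7,8,9,10,11}"
proof -
  have "card {1,2,3,4,5,6,7,8,9,10,11::11} = CARD(11)" by simp
  then show ?thesis by (metis card_subset_eq finite subset_UNIV)
qed

lemma sum_12:
  assumes "\<And>a. a \<notin> {1, 2} \<Longrightarrow> f a = (0::real)"
  shows "sum f UNIV = f 1 + f (2::11)"
proof -
  have "sum f UNIV = sum f {1, 2}"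
    by (rule sum.mono_neutral_right) (use assms in auto)
  then show ?thesis by simp
qed

text \<open>This brings the listed form of \<open>X\<close>, a tower-specific factor times a power
  of \<open>bracket\<close>, into the single monomial required by the locale
  \<open>tower\<close>.\<close>

lemma prod_power_eq_bracket:
  fixes k :: "11 \<Rightarrow> nat"
  shows "(\<Prod>a\<in>UNIV. (P $ a $ a) ^ (if a \<in> {1,2} then 0 else k a + n))
    = (\<Prod>a\<in>{3,4,5,6,7,8,9,10,11}. (P $ a $ a) ^ k a) * bracket P ^ n"
proof -
  let ?S = "{3,4,5,6,7,8,9,10,11} :: 11 set"
  have U: "UNIV = {1,2} \<union> ?S"
    unfolding UNIV_11 by (simp only: Un_insert_left Un_empty_left)
  have disj: "{1,2} \<inter> ?S = {}"
    by simp
  have "(\<Prod>a\<in>UNIV. (P $ a $ a) ^ (if a \<in> {1,2} then 0 else k a + n))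
      = (\<Prod>a\<in>?S. (P $ a $ a) ^ (if a \<in> {1,2} then 0 else k a + n))"
  proof (rule prod.mono_neutral_right)
    show "\<forall>a\<in>UNIV - ?S. (P $ a $ a) ^ (if a \<in> {1,2} then 0 else k a + n) = 1"
    proof
      fix a assume "a \<in> UNIV - ?S"
      then have "a \<in> {1,2}" using U by blast
      then show "(P $ a $ a) ^ (if a \<in> {1,2} then 0 else k a + n) = 1"
        by (simp only: if_True power_0)
    qed
  qed simp_all
  also have "\<dots> = (\<Prod>a\<in>?S. (P $ a $ a) ^ (k a + n))"
  proof (rule prod.cong[OF refl])
    fix a assume "a \<in> ?S"
    then have "a \<notin> {1,2}" using disj by blast
    then show "(P $ a $ a) ^ (if a \<in> {1,2} then 0 else k a + n) = (P $ a $ a) ^ (k a + n)"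
      by (simp only: if_False)
  qed
  finally show ?thesis
    by (simp only: power_add prod.distrib bracket_def prod_power_distrib)
qed

text \<open>
  The exponent \<open>e a\<close> counts how often \<open>g\<^sup>a\<^sup>a\<close> occurs in \<open>X\<close>. It is \<open>p a = q - e a\<close> that makes the
  diagonal Einstein equations hold, and \<open>sign\<close> fixes the admissible time directions.
\<close>

locale tower = exp_diag_metric V \<phi> G s p "{1, 2} :: 11 set" q for V \<phi> G s p q +
  fixes e :: "11 \<Rightarrow> nat" and X :: "real^11^11 \<Rightarrow> real" and \<epsilon> :: real and A :: "real^11 \<Rightarrow> real"
  assumes X: "\<And>P. X P = (\<Prod>a\<in>UNIV. (P $ a $ a) ^ e a)"
    and p_eq: "\<And>a. p a = q - real (e a)"
    and sum_p_square: "(\<Sum>a\<in>UNIV. (p a)\<^sup>2) = 2 * q\<^sup>2 + 2"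
    and sign: "(\<Prod>a\<in>UNIV. s a ^ e a) = - \<epsilon>"
    and eps: "\<epsilon> * \<epsilon> = 1"
    and A: "\<And>x. x \<in> V \<Longrightarrow> A x = exp (- \<phi> x)"
begin

section \<open>The field equation of the potential\<close>

text \<open>As \<open>e a = q - p a\<close>, the sum of \<open>e a * p a\<close> is
  \<open>q * (2 * q) - (2 * q\<^sup>2 + 2) = - 2\<close>, which gives the exponent. The signs
  multiply to \<open>- \<epsilon>\<close> by \<open>sign\<close>.\<close>

lemma X_inv:
  assumes "x \<in> V" shows "X (matrix_inv (G x)) = - \<epsilon> * exp (2 * \<phi> x)"
proof -
  have "(\<Sum>a\<in>UNIV. real (e a) * p a) = (\<Sum>a\<in>UNIV. q * p a - (p a)\<^sup>2)"
    by (rule sum.cong) (auto simp: p_eq power2_eq_square algebra_simps)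
  also have "\<dots> = q * sum p UNIV - (\<Sum>a\<in>UNIV. (p a)\<^sup>2)"
    by (simp add: sum_subtractf sum_distrib_left)
  finally have *: "(\<Sum>a\<in>UNIV. real (e a) * p a) = - 2"
    unfolding sum_p sum_p_square by (simp add: power2_eq_square)
  have "X (matrix_inv (G x)) = (\<Prod>a\<in>UNIV. s a ^ e a) * (\<Prod>a\<in>UNIV. exp (real (e a) * p a * - \<phi> x))"
    by (simp add: X inv_G[OF assms] power_mult_distrib prod.distrib mult.assoc
        flip: exp_of_nat_mult)
  also have "(\<Prod>a\<in>UNIV. exp (real (e a) * p a * - \<phi> x)) = exp (2 * \<phi> x)"
    by (simp only: exp_sum[OF finite_class.finite_UNIV, symmetric] sum_distrib_right[symmetric] *) simp
  finally show ?thesis by (simp add: sign)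
qed

lemma pd_A:
  assumes "x \<in> V" shows "pd i A x = - pd i \<phi> x * exp (- \<phi> x)"
proof -
  have "pd i A x = pd i (\<lambda>y. exp (- \<phi> y)) x"
    by (rule pd_cong[OF open_V assms A])
  also have "\<dots> = - pd i \<phi> x * exp (- \<phi> x)"
    by (rule pd_eqI) (auto intro!: derivative_eq_intros DERIV_\<phi> assms)
  finally show ?thesis .
qed

lemma N_12: "x \<in> V \<Longrightarrow> N x = (pd 1 \<phi> x)\<^sup>2 + (pd 2 \<phi> x)\<^sup>2"
  unfolding N_def by (rule sum_12) (simp add: pd_outside)

lemma field_equation:
  assumes "x \<in> V" shows "field_equation X G A x"
proof -
  have *: "pd i (\<lambda>y. sqrt \<bar>det (G y)\<bar> * matrix_inv (G y) $ i $ j * X (matrix_inv (G y)) * pd j A y) x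
     = (if i = j then \<epsilon> * exp (\<phi> x) * (pd i (pd i \<phi>) x + (pd i \<phi> x)\<^sup>2) else 0)"
    if i: "i \<in> {1, 2}" for i j
  proof -
    have "pd i (\<lambda>y. sqrt \<bar>det (G y)\<bar> * matrix_inv (G y) $ i $ j * X (matrix_inv (G y)) * pd j A y) x
      = pd i (\<lambda>y. if i = j then \<epsilon> * exp (\<phi> y) * pd i \<phi> y else 0) x"
    \<comment> \<open>The volume density cancels the inverse metric entry, and \<open>X\<close>
      cancels the square of \<open>exp (- \<phi>)\<close> up to sign. The flux becomes
      \<open>\<epsilon>\<close> times the gradient of \<open>exp \<phi>\<close>.\<close>
    proof (rule pd_cong[OF open_V assms])
      fix y assume y: "y \<in> V"
      have inv: "matrix_inv (G y) $ i $ j = (if i = j then exp (- q * \<phi> y) else 0)"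
        using s_B[OF i] p_B[OF i] by (auto simp: inv_G[OF y])
      have "exp (q * \<phi> y) * exp (- q * \<phi> y) = 1"
        by (simp add: exp_minus)
      moreover have "exp (2 * \<phi> y) * exp (- \<phi> y) = exp (\<phi> y)"
        by (simp flip: exp_add)
      ultimately have "exp (q * \<phi> y) * exp (- q * \<phi> y) * (- \<epsilon> * exp (2 * \<phi> y)) * (- pd i \<phi> y * exp (- \<phi> y))
          = \<epsilon> * exp (\<phi> y) * pd i \<phi> y"
        by algebra
      then show "sqrt \<bar>det (G y)\<bar> * matrix_inv (G y) $ i $ j * X (matrix_inv (G y)) * pd j A y
          = (if i = j then \<epsilon> * exp (\<phi> y) * pd i \<phi> y else 0)"
        unfolding sqrt_det_G[OF y] X_inv[OF y] pd_A[OF y] inv by (cases "i = j") simp_all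
    qed
    also have "\<dots> = (if i = j then \<epsilon> * exp (\<phi> x) * (pd i (pd i \<phi>) x + (pd i \<phi> x)\<^sup>2) else 0)"
      by (cases "i = j")
        (auto intro!: pd_eqI derivative_eq_intros DERIV_\<phi> assms
          simp: algebra_simps power2_eq_square)
    finally show ?thesis .
  qed
  have "(\<Sum>i\<in>UNIV. pd i (pd i \<phi>) x) = pd 1 (pd 1 \<phi>) x + pd 2 (pd 2 \<phi>) x"
    by (rule sum_12) (rule pd_pd_outside[OF assms])
  then have "pd 1 (pd 1 \<phi>) x + pd 2 (pd 2 \<phi>) x + ((pd 1 \<phi> x)\<^sup>2 + (pd 2 \<phi> x)\<^sup>2) = 0"
    using lap[OF assms] N_12[OF assms] by (simp add: N_def)
  then have "\<epsilon> * exp (\<phi> x) * (pd 1 (pd 1 \<phi>) x + (pd 1 \<phi> x)\<^sup>2)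
      + \<epsilon> * exp (\<phi> x) * (pd 2 (pd 2 \<phi>) x + (pd 2 \<phi> x)\<^sup>2) = 0"
    by algebra
  then show ?thesis
    unfolding field_equation_def by (simp add: *)
qed

section \<open>Energy-momentum tensor and Einstein equations\<close>

text \<open>Dividing by the entry instead of lowering its exponent expresses the derivative through
  \<open>X P\<close>, whose value on the solution is known. Off-diagonal entries do not occur in
  \<open>X\<close>.\<close>

lemma DERIV_X:
  assumes "P $ \<mu> $ \<mu> \<noteq> 0"
  shows "((\<lambda>t. X (P + t *\<^sub>R axis \<mu> (axis \<nu> 1))) has_real_derivative
    (if \<mu> = \<nu> then real (e \<mu>) * X P / P $ \<mu> $ \<mu> else 0)) (at 0)"
proof -
  have entry: "(P + t *\<^sub>R axis \<mu> (axis \<nu> 1)) $ a $ a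
      = P $ a $ a + (if a = \<mu> \<and> \<mu> = \<nu> then t else 0)" for t a
    by (auto simp: axis_def)
  let ?R = "\<Prod>a\<in>UNIV - {\<mu>}. (P $ a $ a) ^ e a"
  have split: "X (P + t *\<^sub>R axis \<mu> (axis \<nu> 1))
      = (P $ \<mu> $ \<mu> + (if \<mu> = \<nu> then t else 0)) ^ e \<mu> * ?R" for t
    unfolding X entry by (subst prod.remove[of _ \<mu>]) auto
  have "X P = (P $ \<mu> $ \<mu>) ^ e \<mu> * ?R"
    using split[of 0] by simp
  moreover have "((\<lambda>t. (P $ \<mu> $ \<mu> + (if \<mu> = \<nu> then t else 0)) ^ e \<mu> * ?R) has_real_derivative
    (if \<mu> = \<nu> then real (e \<mu>) * (P $ \<mu> $ \<mu>) ^ (e \<mu> - 1) * ?R else 0)) (at 0)"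
    by (cases "\<mu> = \<nu>") (auto intro!: derivative_eq_intros)
  \<comment> \<open>For \<open>e \<mu> = 0\<close> the truncated exponent \<open>e \<mu> - 1\<close>
    is harmless because of the factor \<open>real (e \<mu>)\<close>.\<close>
  moreover have "real (e \<mu>) * (P $ \<mu> $ \<mu>) ^ (e \<mu> - 1) * ?R
      = real (e \<mu>) * ((P $ \<mu> $ \<mu>) ^ e \<mu> * ?R) / P $ \<mu> $ \<mu>"
    using assms by (cases "e \<mu>") simp_all
  ultimately show ?thesis unfolding split by (simp only:)
qed

text \<open>The entries at (1,2) and (2,1) are varied independently, so no factor 2 arises off the
  diagonal.\<close>

lemma DERIV_kinetic:
  fixes d :: "11 \<Rightarrow> real"
  shows "((\<lambda>t. \<Sum>i\<in>{1,2}. \<Sum>j\<in>{1,2}. (P + t *\<^sub>R axis \<mu> (axis \<nu> 1)) $ i $ j * d i * d j)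
    has_real_derivative (if \<mu> \<in> {1,2} \<and> \<nu> \<in> {1,2} then d \<mu> * d \<nu> else 0)) (at 0)"
proof -
  have entry: "(P + t *\<^sub>R axis \<mu> (axis \<nu> 1)) $ i $ j
      = P $ i $ j + t * (if i = \<mu> \<and> j = \<nu> then 1 else 0)" for t i j
    by (auto simp: axis_def)
  have "((\<lambda>t. \<Sum>i\<in>{1,2}. \<Sum>j\<in>{1,2}. (P + t *\<^sub>R axis \<mu> (axis \<nu> 1)) $ i $ j * d i * d j)
    has_real_derivative (\<Sum>i\<in>{1,2}. \<Sum>j\<in>{1,2}. (if i = \<mu> \<and> j = \<nu> then 1 else 0) * d i * d j)) (at 0)"
    unfolding entry by (intro DERIV_sum) (auto intro!: derivative_eq_intros)
  also have "(\<Sum>i\<in>{1,2}. \<Sum>j\<in>{1,2}. (if i = \<mu> \<and> j = \<nu> then 1 else 0) * d i * d j)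
      = (if \<mu> \<in> {1,2} \<and> \<nu> \<in> {1,2} then d \<mu> * d \<nu> else 0)"
    by auto
  finally show ?thesis .
qed

lemma energy_momentum_mixed:
  assumes "x \<in> V"
  shows "(matrix_inv (G x) ** energy_momentum \<epsilon> X G A x) $ \<mu> $ \<nu> = exp (- q * \<phi> x) *
    ((if \<mu> = \<nu> then (1/4 - 1/2 * real (e \<mu>)) * N x else 0) - 1/2 * pd \<mu> \<phi> x * pd \<nu> \<phi> x)"
proof -
  let ?P = "matrix_inv (G x)" and ?d = "\<lambda>i. pd i A x" and ?f = "\<lambda>i. pd i \<phi> x"
  let ?K = "\<Sum>i\<in>{1,2}. \<Sum>j\<in>{1,2}. ?P $ i $ j * ?d i * ?d j"
  have P: "?P $ a $ b = (if a = b then s a * exp (- p a * \<phi> x) else 0)" for a b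
    by (simp add: inv_G[OF assms])
  have nz: "?P $ \<mu> $ \<mu> \<noteq> 0"
    using s_square[of \<mu>] by (auto simp: P)
  \<comment> \<open>The two factors \<open>exp (- \<phi> x)\<close> from the derivatives of
    \<open>A\<close> are compensated exactly by the \<open>exp (2 * \<phi> x)\<close> in
    \<open>X\<close>.\<close>
  have exp3: "exp (2 * \<phi> x) * (exp (- \<phi> x) * exp (- \<phi> x)) = 1"
    by (simp flip: exp_add)
  have XK: "X ?P * ?K = - \<epsilon> * (exp (- q * \<phi> x) * N x)"
  proof -
    have "?K = exp (- q * \<phi> x) * N x * (exp (- \<phi> x) * exp (- \<phi> x))"
      using s_B[of 1] s_B[of 2] p_B[of 1] p_B[of 2]
      by (simp add: P pd_A[OF assms] N_12[OF assms] power2_eq_square algebra_simps)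
    then have "X ?P * ?K = - \<epsilon> * (exp (- q * \<phi> x) * N x) * (exp (2 * \<phi> x) * (exp (- \<phi> x) * exp (- \<phi> x)))"
      by (simp only: X_inv[OF assms] mult_ac minus_mult_left)
    then show ?thesis by (simp only: exp3 mult_1_right)
  qed
  have Xd: "X ?P * (?d \<mu> * ?d \<nu>) = - \<epsilon> * (?f \<mu> * ?f \<nu>)"
  proof -
    have "X ?P * (?d \<mu> * ?d \<nu>) = - \<epsilon> * (?f \<mu> * ?f \<nu>) * (exp (2 * \<phi> x) * (exp (- \<phi> x) * exp (- \<phi> x)))"
      by (simp add: X_inv[OF assms] pd_A[OF assms] mult_ac)
    then show ?thesis by (simp only: exp3 mult_1_right)
  qed
  have outside: "(if \<mu> \<in> {1,2} \<and> \<nu> \<in> {1,2} then ?d \<mu> * ?d \<nu> else 0) = ?d \<mu> * ?d \<nu>"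
    using pd_outside[OF assms, of \<mu>] pd_outside[OF assms, of \<nu>] by (auto simp: pd_A[OF assms])
  have matter: "matter_term \<epsilon> X ?P ?d = 1/2 * exp (- q * \<phi> x) * N x"
    unfolding matter_term_def field_strength_sq_def XK using eps by simp
  have "matter_term_deriv \<epsilon> X ?P ?d \<mu> \<nu> = - (\<epsilon> / 2) *
      ((if \<mu> = \<nu> then real (e \<mu>) * X ?P / ?P $ \<mu> $ \<mu> else 0) * ?K + ?d \<mu> * ?d \<nu> * X ?P)"
    unfolding matter_term_deriv_def matter_term_def field_strength_sq_def
    using DERIV_cmult[OF DERIV_mult[OF DERIV_X[OF nz, of \<nu>] DERIV_kinetic[of ?P \<mu> \<nu> ?d]], of "- (\<epsilon> / 2)"]
    by (intro DERIV_imp_deriv) (simp only: outside scaleR_zero_left add_0_right)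
  also have "\<dots> = - (\<epsilon> / 2) * ((if \<mu> = \<nu> then real (e \<mu>) * (X ?P * ?K) / ?P $ \<mu> $ \<mu> else 0)
      + X ?P * (?d \<mu> * ?d \<nu>))"
    by (simp add: mult_ac del: sum.insert)
  also have "\<dots> = (\<epsilon> * \<epsilon>) / 2 * ((if \<mu> = \<nu> then real (e \<mu>) * (exp (- q * \<phi> x) * N x) / ?P $ \<mu> $ \<mu> else 0)
      + ?f \<mu> * ?f \<nu>)"
    unfolding XK Xd by (simp add: algebra_simps)
  finally have deriv: "matter_term_deriv \<epsilon> X ?P ?d \<mu> \<nu>
      = 1/2 * ((if \<mu> = \<nu> then real (e \<mu>) * (exp (- q * \<phi> x) * N x) / ?P $ \<mu> $ \<mu> else 0)
      + ?f \<mu> * ?f \<nu>)"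
    unfolding eps by simp
  have 1: "?P $ \<mu> $ \<mu> * ?f \<mu> = exp (- q * \<phi> x) * ?f \<mu>"
    using pd_outside[OF assms, of \<mu>] s_B[of \<mu>] p_B[of \<mu>]
    by (cases "\<mu> \<in> {1,2}") (auto simp: P)
  have 2: "?P $ \<mu> $ \<mu> * G x $ \<mu> $ \<nu> = (if \<mu> = \<nu> then 1 else 0)"
    using s_square[of \<mu>] unfolding P by (auto simp: G[OF assms] exp_minus field_simps)
  have "(?P ** energy_momentum \<epsilon> X G A x) $ \<mu> $ \<nu>
      = ?P $ \<mu> $ \<mu> * energy_momentum \<epsilon> X G A x $ \<mu> $ \<nu>"
    by (simp add: matrix_matrix_mult_def P sum_delta_mult)
  also have "\<dots> = - 1/2 * (if \<mu> = \<nu> then real (e \<mu>) * (exp (- q * \<phi> x) * N x) else 0)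
      - 1/2 * (?P $ \<mu> $ \<mu> * ?f \<mu>) * ?f \<nu>
      + 1/4 * (?P $ \<mu> $ \<mu> * G x $ \<mu> $ \<nu>) * (exp (- q * \<phi> x) * N x)"
    using nz unfolding energy_momentum_def vec_lambda_beta deriv matter
    by (cases "\<mu> = \<nu>") (simp_all add: field_simps)
  also have "\<dots> = exp (- q * \<phi> x) *
    ((if \<mu> = \<nu> then (1/4 - 1/2 * real (e \<mu>)) * N x else 0) - 1/2 * ?f \<mu> * ?f \<nu>)"
    unfolding 1 2 by (simp add: field_simps)
  finally show ?thesis .
qed

text \<open>By \<open>sum_p_square\<close> the gradient products have coefficient -1/2 on both
  sides. After removal of \<open>exp (- q * \<phi> x) * N x\<close>, the diagonal terms agree
  because \<open>p a / 2 - (q - 1/2) / 2 = 1/4 - e a / 2\<close>, which is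
  \<open>p_eq\<close>.\<close>

lemma einstein_equations:
  assumes "x \<in> V" shows "einstein_equations \<epsilon> X G A x"
  unfolding einstein_equations_def ricci_mixed[OF assms] scalar_curvature_eq[OF assms]
    energy_momentum_mixed[OF assms] sum_p_square
  by (auto simp: p_eq field_simps)

end

section \<open>Functions of the first two coordinates and the logarithm of a harmonic
  function\<close>

lemma bounded_linear_xy: "bounded_linear xy"
  unfolding linear_conv_bounded_linear[symmetric]
  by (rule linearI) (simp_all add: xy_def vec_eq_iff forall_2)

lemma xy_axis:
  "xy (axis i 1) = (if i = 1 then axis 1 1 else if i = 2 then axis 2 1 else 0)"
  by (auto simp: xy_def vec_eq_iff forall_2 axis_def)

lemma has_derivative_comp_xy:
  assumes "(f has_derivative f') (at (xy x))"
  shows "((\<lambda>x. f (xy x)) has_derivative (\<lambda>h. f' (xy h))) (at x)"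
  by (rule has_derivative_compose[OF bounded_linear_imp_has_derivative[OF bounded_linear_xy] assms])

lemma differentiable_comp_xy:
  assumes "f differentiable (at (xy x))"
  shows "(\<lambda>x. f (xy x)) differentiable (at x)"
  using assms has_derivative_comp_xy unfolding differentiable_def by blast

lemma pd_comp_xy:
  fixes f :: "real^2 \<Rightarrow> real"
  assumes "f differentiable (at (xy x))"
  shows "pd i (\<lambda>x. f (xy x)) x
    = (if i = 1 then pd 1 f (xy x) else if i = 2 then pd 2 f (xy x) else 0)"
proof -
  obtain f' where f': "(f has_derivative f') (at (xy x))"
    using assms unfolding differentiable_def by blast
  have "f' 0 = 0"
    using linear_simps(3)[OF has_derivative_bounded_linear[OF f']] .
  then show ?thesis
    by (simp add: pd_has_derivative[OF has_derivative_comp_xy[OF f']] pd_has_derivative[OF f'] xy_axis)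
qed

lemma pd_ln:
  fixes f :: "real^'n::finite \<Rightarrow> real"
  assumes "f differentiable (at x)" "f x > 0"
  shows "pd i (\<lambda>y. ln (f y)) x = pd i f x / f x"
  by (rule pd_eqI) (auto intro!: derivative_eq_intros DERIV_pd assms)

text \<open>Subtracting the square of the derivative of \<open>ln f\<close> itself lets a sum over
  the two directions turn harmonicity of \<open>f\<close> directly into the condition
  \<open>lap\<close>.\<close>

lemma pd_pd_ln:
  fixes f :: "real^'n::finite \<Rightarrow> real"
  assumes V: "open V" "x \<in> V"
    and f: "\<And>y. y \<in> V \<Longrightarrow> f differentiable (at y)" "\<And>y. y \<in> V \<Longrightarrow> f y > 0"
    and g: "pd i f differentiable (at x)"
  shows "pd i (pd i (\<lambda>y. ln (f y))) x = pd i (pd i f) x / f x - (pd i (\<lambda>y. ln (f y)) x)\<^sup>2"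
proof -
  have "pd i (pd i (\<lambda>y. ln (f y))) x = pd i (\<lambda>y. pd i f y / f y) x"
    by (rule pd_cong[OF V]) (simp add: pd_ln f)
  also have "\<dots> = pd i (pd i f) x / f x - (pd i f x / f x)\<^sup>2"
    using f(2)[OF V(2)]
    by (intro pd_eqI)
      (auto intro!: derivative_eq_intros DERIV_pd f(1) V g simp: field_simps power2_eq_square)
  finally show ?thesis using f[OF V(2)] by (simp add: pd_ln)
qed

text \<open>This separates the analysis from the arithmetic: for each tower there remain identities
  for the exponents and one parity condition on the time directions.\<close>

lemma solves_eom_tower:
  fixes U :: "(real^2) set" and H :: "real^2 \<Rightarrow> real" and e :: "11 \<Rightarrow> nat"
  assumes U: "open U" and H: "C2_on U H"
    and pos: "\<And>y. y \<in> U \<Longrightarrow> H y > 0"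
    and harmonic: "\<And>y. y \<in> U \<Longrightarrow> pd 1 (pd 1 H) y + pd 2 (pd 2 H) y = 0"
    and T: "1 \<notin> T" "2 \<notin> T"
    and e: "e 1 = 0" "e 2 = 0" "\<And>a. p a = q - real (e a)"
    and X: "\<And>P. X P = (\<Prod>a\<in>UNIV. (P $ a $ a) ^ e a)"
    and sum_p: "sum p UNIV = 2 * q" "(\<Sum>a\<in>UNIV. (p a)\<^sup>2) = 2 * q\<^sup>2 + 2"
    and sign: "(\<Prod>a\<in>T. (-1) ^ e a) = - time_sign T"
  shows "solves_eom U H T p X"
proof -
  define V where "V = xy -` U"
  define \<psi> where "\<psi> = (\<lambda>y. ln (H y))"
  define \<phi> where "\<phi> = (\<lambda>x. \<psi> (xy x))"
  have V: "open V"
    unfolding V_def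
    by (rule open_vimage[OF U linear_continuous_on[OF bounded_linear_xy]])
  have dH: "H differentiable (at y)" "\<And>i. pd i H differentiable (at y)" if "y \<in> U" for y
    using H that U unfolding C2_on_def by (auto simp: differentiable_on_eq_differentiable_at)
  have d\<psi>: "\<psi> differentiable (at y)" if y: "y \<in> U" for y
  proof -
    obtain H' where "(H has_derivative H') (at y)"
      using dH(1)[OF y] unfolding differentiable_def by blast
    then have "(\<psi> has_derivative (\<lambda>h. H' h * inverse (H y))) (at y)"
      unfolding \<psi>_def using pos[OF y] by (auto intro!: derivative_eq_intros simp: field_simps)
    then show ?thesis unfolding differentiable_def by blast
  qed
  have pd\<psi>: "pd i \<psi> y = pd i H y / H y" if "y \<in> U" for i y
    unfolding \<psi>_def by (rule pd_ln[OF dH(1)[OF that] pos[OF that]])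
  have dpd\<psi>: "pd i \<psi> differentiable (at y)" if y: "y \<in> U" for i y
  proof -
    have "(\<lambda>y. pd i H y / H y) differentiable (at y)"
      using dH[OF y] pos[OF y] by (intro differentiable_divide) auto
    then obtain D where "((\<lambda>y. pd i H y / H y) has_derivative D) (at y)"
      unfolding differentiable_def by blast
    \<comment> \<open>The quotient formula for \<open>pd i \<psi>\<close> is known only on
      \<open>U\<close>, so differentiability is transferred within this open set.\<close>
    then have "(pd i \<psi> has_derivative D) (at y)"
      by (rule has_derivative_transform_within_open[OF _ U y]) (simp add: pd\<psi>)
    then show ?thesis unfolding differentiable_def by blast
  qed
  have pd\<phi>: "pd i \<phi> x = (if i = 1 then pd 1 \<psi> (xy x) else if i = 2 then pd 2 \<psi> (xy x) else 0)"
    if "x \<in> V" for i x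
    unfolding \<phi>_def by (rule pd_comp_xy[OF d\<psi>]) (use that V_def in simp)
  have dpd: "(\<lambda>x. if i = 1 then pd 1 \<psi> (xy x) else if i = 2 then pd 2 \<psi> (xy x) else 0)
      differentiable (at x)" if "x \<in> V" for i :: 11 and x
    using that dpd\<psi>[THEN differentiable_comp_xy] unfolding V_def
    by (cases "i = 1"; cases "i = 2") auto
  have pdpd\<phi>: "pd i (pd i \<phi>) x
      = (if i = 1 then pd 1 (pd 1 \<psi>) (xy x) else if i = 2 then pd 2 (pd 2 \<psi>) (xy x) else 0)"
    if x: "x \<in> V" for i x
  proof -
    have "pd i (pd i \<phi>) x
        = pd i (\<lambda>x. if i = 1 then pd 1 \<psi> (xy x) else if i = 2 then pd 2 \<psi> (xy x) else 0) x"
      by (rule pd_cong[OF V x]) (rule pd\<phi>)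
    then show ?thesis
      using x pd_comp_xy[OF dpd\<psi>, of x] by (simp add: V_def)
  qed
  interpret tower V \<phi> "diag_metric T p H" "\<lambda>a. if a \<in> T then -1 else 1" p q e X "time_sign T"
    "\<lambda>x. 1 / H (xy x)"
  proof
    fix x assume x: "x \<in> V"
    then have y: "xy x \<in> U" by (simp add: V_def)
    show "\<phi> differentiable (at x)"
      unfolding \<phi>_def by (rule differentiable_comp_xy[OF d\<psi>[OF y]])
    show "pd i \<phi> differentiable (at x)" for i
    proof -
      obtain D where "((\<lambda>x. if i = 1 then pd 1 \<psi> (xy x) else if i = 2 then pd 2 \<psi> (xy x) else 0)
          has_derivative D) (at x)"
        using dpd[OF x, of i] unfolding differentiable_def by blast
      then have "(pd i \<phi> has_derivative D) (at x)"
        by (rule has_derivative_transform_within_open[OF _ V x]) (simp add: pd\<phi>)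
      then show ?thesis unfolding differentiable_def by blast
    qed
    show "pd a \<phi> x = 0" if "a \<notin> {1, 2}" for a
      using that by (simp add: pd\<phi>[OF x])
    have pdpd\<psi>: "pd i (pd i \<psi>) (xy x) = pd i (pd i H) (xy x) / H (xy x) - (pd i \<psi> (xy x))\<^sup>2" for i
      unfolding \<psi>_def by (rule pd_pd_ln[OF U y dH(1) pos dH(2)[OF y]])
    have "pd 1 (pd 1 H) (xy x) / H (xy x) + pd 2 (pd 2 H) (xy x) / H (xy x) = 0"
      using harmonic[OF y] by (simp flip: add_divide_distrib)
    moreover have "(\<Sum>i\<in>UNIV. pd i (pd i \<phi>) x) = pd 1 (pd 1 \<psi>) (xy x) + pd 2 (pd 2 \<psi>) (xy x)"
      by (subst sum_12) (simp_all add: pdpd\<phi>[OF x])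
    moreover have "(\<Sum>i\<in>UNIV. (pd i \<phi> x)\<^sup>2) = (pd 1 \<psi> (xy x))\<^sup>2 + (pd 2 \<psi> (xy x))\<^sup>2"
      by (subst sum_12) (simp_all add: pd\<phi>[OF x])
    ultimately show "(\<Sum>i\<in>UNIV. pd i (pd i \<phi>) x) = - (\<Sum>i\<in>UNIV. (pd i \<phi> x)\<^sup>2)"
      unfolding pdpd\<psi> by linarith
    show "diag_metric T p H x
        = (\<chi> a b. if a = b then (if a \<in> T then -1 else 1) * exp (p a * \<phi> x) else 0)"
      using pos[OF y] by (simp add: diag_metric_def \<phi>_def \<psi>_def powr_def vec_eq_iff)
    show "1 / H (xy x) = exp (- \<phi> x)"
      using pos[OF y] by (simp add: \<phi>_def \<psi>_def exp_minus field_simps)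
  next
    have "(\<Prod>a\<in>UNIV. (if a \<in> T then - 1 else 1) ^ e a) = (\<Prod>a\<in>T. (if a \<in> T then - 1 else 1::real) ^ e a)"
      by (rule prod.mono_neutral_right) auto
    also have "\<dots> = (\<Prod>a\<in>T. (-1) ^ e a)" by (rule prod.cong) auto
    finally show "(\<Prod>a\<in>UNIV. (if a \<in> T then - 1 else 1) ^ e a) = - time_sign T"
      using sign by simp
  qed (use V T e X sum_p in \<open>auto simp: time_sign_def\<close>)
  show ?thesis
    unfolding solves_eom_def Let_def
    using field_equation einstein_equations by (simp add: V_def)
qed

section \<open>Exponents and signs of the three towers\<close>

theorem mainTheorem6:
  fixes n :: nat and U :: "(real^2) set" and H :: "real^2 \<Rightarrow> real"
  assumes "open U"
    and "C2_on U H"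
    and "\<And>y. y \<in> U \<Longrightarrow> H y > 0"
    and "\<And>y. y \<in> U \<Longrightarrow> pd 1 (pd 1 H) y + pd 2 (pd 2 H) y = 0"
  shows "(\<forall>T\<in>times_3 n. solves_eom U H T (exps_3 n) (X_3 n)) \<and>
         (\<forall>T\<in>times_6 n. solves_eom U H T (exps_6 n) (X_6 n)) \<and>
         (\<forall>T\<in>times_81 n. solves_eom U H T (exps_81 n) (X_81 n))"
proof (intro conjI ballI)
  note solves = solves_eom_tower[OF assms]
  {
    fix T assume T: "T \<in> times_3 n"
    show "solves_eom U H T (exps_3 n) (X_3 n)"
    proof (rule solves)
      \<comment> \<open>The multiplicity is the one in the tower-specific factor, plus
        \<open>n\<close> from the power of \<open>bracket\<close> in the directions 3 to 11.\<close>
      let ?e = "\<lambda>a::11. if a \<in> {1,2} then 0 else (if a \<in> {9,10,11} then 1 else 0) + n"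
      have "\<forall>a\<in>UNIV. exps_3 n a = (1/3 + real n) - real (?e a)"
        unfolding UNIV_11 ball_simps by (simp add: exps_3_def)
      then show "exps_3 n a = (1/3 + real n) - real (?e a)" for a
        by blast
      show "X_3 n P = (\<Prod>a\<in>UNIV. (P $ a $ a) ^ ?e a)" for P
        unfolding prod_power_eq_bracket X_3_def by simp
      show "sum (exps_3 n) UNIV = 2 * (1/3 + real n)"
        unfolding UNIV_11 by (simp add: exps_3_def)
      \<comment> \<open>The directions 3 to 11 contribute \<open>6 * (1/9) + 3 * (4/9) = 2\<close>;
        the same count serves the 6-tower.\<close>
      show "(\<Sum>a\<in>UNIV. (exps_3 n a)\<^sup>2) = 2 * (1/3 + real n)\<^sup>2 + 2"
        unfolding UNIV_11 by (simp add: exps_3_def power2_eq_square)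
      \<comment> \<open>For all listed \<open>T\<close>, here and in the other two towers, every
        time direction has odd multiplicity. The product is then -1 to the power
        \<open>card T\<close>, which is \<open>- time_sign T\<close>.\<close>
      show "(\<Prod>a\<in>T. (-1) ^ ?e a) = - time_sign T"
        using T by (auto simp: times_3_def time_sign_def split: if_splits)
    qed (use T in \<open>auto simp: times_3_def split: if_splits\<close>)
  next
    fix T assume T: "T \<in> times_6 n"
    show "solves_eom U H T (exps_6 n) (X_6 n)"
    proof (rule solves)
      let ?e = "\<lambda>a::11. if a \<in> {1,2} then 0 else (if a \<in> {3,4,5,6,7,8} then 1 else 0) + n"
      have "\<forall>a\<in>UNIV. exps_6 n a = (2/3 + real n) - real (?e a)"
        unfolding UNIV_11 ball_simps by (simp add: exps_6_def)
      then show "exps_6 n a = (2/3 + real n) - real (?e a)" for a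
        by blast
      show "X_6 n P = (\<Prod>a\<in>UNIV. (P $ a $ a) ^ ?e a)" for P
        unfolding prod_power_eq_bracket X_6_def by simp
      show "sum (exps_6 n) UNIV = 2 * (2/3 + real n)"
        unfolding UNIV_11 by (simp add: exps_6_def)
      show "(\<Sum>a\<in>UNIV. (exps_6 n a)\<^sup>2) = 2 * (2/3 + real n)\<^sup>2 + 2"
        unfolding UNIV_11 by (simp add: exps_6_def power2_eq_square)
      show "(\<Prod>a\<in>T. (-1) ^ ?e a) = - time_sign T"
        using T by (auto simp: times_6_def time_sign_def split: if_splits)
    qed (use T in \<open>auto simp: times_6_def split: if_splits\<close>)
  next
    fix T assume T: "T \<in> times_81 n"
    show "solves_eom U H T (exps_81 n) (X_81 n)"
    proof (rule solves)
      \<comment> \<open>Direction 3 is absent from the factor outside \<open>bracket\<close>, and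
        direction 11 occurs there squared. The exponents 1 and -1 of these two directions supply the
        required 2 in the sum of squares.\<close>
      let ?e = "\<lambda>a::11. if a \<in> {1,2} then 0 else (if a = 3 then 0 else if a = 11 then 2 else 1) + n"
      have "\<forall>a\<in>UNIV. exps_81 n a = (real n + 1) - real (?e a)"
        unfolding UNIV_11 ball_simps by (simp add: exps_81_def)
      then show "exps_81 n a = (real n + 1) - real (?e a)" for a
        by blast
      show "X_81 n P = (\<Prod>a\<in>UNIV. (P $ a $ a) ^ ?e a)" for P
        unfolding prod_power_eq_bracket X_81_def by simp
      show "sum (exps_81 n) UNIV = 2 * (real n + 1)"
        unfolding UNIV_11 by (simp add: exps_81_def)
      show "(\<Sum>a\<in>UNIV. (exps_81 n a)\<^sup>2) = 2 * (real n + 1)\<^sup>2 + 2"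
        unfolding UNIV_11 by (simp add: exps_81_def power2_eq_square)
      show "(\<Prod>a\<in>T. (-1) ^ ?e a) = - time_sign T"
        using T by (auto simp: times_81_def time_sign_def split: if_splits)
    qed (use T in \<open>auto simp: times_81_def split: if_splits\<close>)
  }
qed

end
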